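(* Let $R$ be a GCD domain, let $(G,\alpha)$ be an arbitrary edge labeled graph with $n$ vertices $v_1,\dots,v_n$, and let $\{F_1,F_2,\dots,F_n\}\subset R_{(G,\alpha)}$. Then $\{F_1,F_2,\dots,F_n\}$ forms an $R$-module basis of $R_{(G,\alpha)}$ if and only if $\big| F_1 \ F_2 \ \cdots \ F_n \big| = r\cdot Q_G$ where $r\in R$ is a unit.
   Context: A GCD domain is an integral domain in which any two elements have a greatest common divisor. Gcds and lcms are defined up to units. $G$ is a finite graph with ordered vertex set $V(G)=\{v_1,\dots,v_n\}$ and edge set $E(G)$. An edge labeling $\alpha$ assigns to each edge $uv$ a principal ideal of $R$; a generator is denoted $l_{uv}$ and is also called the edge label. A (generalized) spline on $(G,\alpha)$ is a tuple $F=(F(v_1),\dots,F(v_n))\in R^n$ such that $F(u)-F(v)\in\alpha(uv)$, i.e. $l_{uv}$ divides $F(u)-F(v)$, for every edge $uv\in E(G)$. The set $R_{(G,\alpha)}$ of all splines is an $R$-module under componentwise operations. A trail is a sequence of vertices and edges, each edge joining the consecutive vertices, in which no edge is repeated. For $i>1$, a zero trail of $v_i$ is a trail in $G$ starting at $v_i$ and ending at some $v_j$ with $j<i$. For a trail $p$, $(p)$ denotes the gcd of the labels of its edges. For $i\ge 2$, $\mathscr{L}_i$ is the lcm of the elements $(p)$ over all zero trails $p$ of $v_i$, and $\mathscr{L}_1=1$. Put $Q_G=\prod_{i=1}^n \mathscr{L}_i$. $\big| F_1 \ F_2 \ \cdots \ F_n \big|$ is the determinant of the $n\times n$ matrix whose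 $k$-th column is $(F_k(v_n),\dots,F_k(v_2),F_k(v_1))^T$.
   Formalization: All edge labels are assumed nonzero; if some edge has label 0, then Q_G = 0 and every determinant of n splines is 0, so the stated equivalence fails (e.g. two vertices, one edge labeled 0, F_1 = F_2 = 0). *)

theory Defs
  imports
    "HOL-Library.Function_Algebras"
    "Jordan_Normal_Form.Determinant"
begin

text \<open>
  GCD domains are types of sort \<open>{idom, ring_gcd}\<close>. The operations that \<open>ring_gcd\<close>
  adds to an integral domain (\<open>gcd\<close>, \<open>lcm\<close>, \<open>normalize\<close>, \<open>unit_factor\<close>, \<open>div\<close>) amount to a choice
  of one representative in each class of associates, which exists in every GCD domain; no
  multiplicativity of the normalization is assumed.

  The vertex set of a graph is a whole finite type \<open>'v\<close>, ordered by an enumeration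
  \<open>v 1, \<dots>, v n\<close> of \<open>'v\<close>; its edges are two-element sets of vertices.
\<close>

definition simple_graph :: "'v set set \<Rightarrow> bool" where
  "simple_graph E \<longleftrightarrow> (\<forall>e\<in>E. card e = 2)"

definition principal_ideal :: "'a::comm_ring_1 \<Rightarrow> 'a set" where
  "principal_ideal a = range (\<lambda>r. r * a)"

text \<open>
  The labeling \<open>\<alpha>\<close> takes ideals as values and \<open>l\<close> chooses a generator of each of them.
  Labels are nonzero: with a zero label both the determinant of any \<open>n\<close> splines and the element
  \<open>Q\<close> below vanish, whereas no \<open>n\<close> distinct splines form a basis.
\<close>

definition edge_labeling ::
    "'v set set \<Rightarrow> ('v set \<Rightarrow> 'a::comm_ring_1 set) \<Rightarrow> ('v set \<Rightarrow> 'a) \<Rightarrow> bool" where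
  "edge_labeling E \<alpha> l \<longleftrightarrow> (\<forall>e\<in>E. \<alpha> e = principal_ideal (l e) \<and> l e \<noteq> 0)"

definition splines :: "'v set set \<Rightarrow> ('v set \<Rightarrow> 'a::comm_ring_1 set) \<Rightarrow> ('v \<Rightarrow> 'a) set" where
  "splines E \<alpha> = {F. \<forall>x y. {x, y} \<in> E \<longrightarrow> F x - F y \<in> \<alpha> {x, y}}"

definition fun_scale :: "'a::comm_ring_1 \<Rightarrow> ('v \<Rightarrow> 'a) \<Rightarrow> ('v \<Rightarrow> 'a)" where
  "fun_scale r F = (\<lambda>x. r * F x)"

global_interpretation fun_mod: Modules.module "fun_scale :: 'a::comm_ring_1 \<Rightarrow> ('v \<Rightarrow> 'a) \<Rightarrow> _"
  by unfold_locales (auto simp: fun_scale_def algebra_simps fun_eq_iff)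

definition module_basis :: "('v \<Rightarrow> 'a::comm_ring_1) set \<Rightarrow> ('v \<Rightarrow> 'a) set \<Rightarrow> bool" where
  "module_basis B M \<longleftrightarrow> fun_mod.independent B \<and> fun_mod.span B = M"

lemma splines_iff_dvd:
  assumes "edge_labeling E \<alpha> l"
  shows "F \<in> splines E \<alpha> \<longleftrightarrow> (\<forall>x y. {x, y} \<in> E \<longrightarrow> l {x, y} dvd F x - F y)"
  using assms
  by (auto simp: splines_def edge_labeling_def principal_ideal_def dvd_def image_iff mult.commute)

lemma subspace_splines:
  assumes "edge_labeling E \<alpha> l"
  shows "fun_mod.subspace (splines E \<alpha>)"
  unfolding fun_mod.subspace_def
proof (intro conjI ballI allI)
  show "0 \<in> splines E \<alpha>"
    by (simp add: splines_iff_dvd[OF assms])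
next
  fix F G assume *: "F \<in> splines E \<alpha>" "G \<in> splines E \<alpha>"
  have "l {x, y} dvd (F + G) x - (F + G) y" if "{x, y} \<in> E" for x y
  proof -
    have "l {x, y} dvd (F x - F y) + (G x - G y)"
      using * that by (intro dvd_add) (auto simp: splines_iff_dvd[OF assms])
    then show ?thesis by (simp add: algebra_simps)
  qed
  then show "F + G \<in> splines E \<alpha>"
    by (auto simp: splines_iff_dvd[OF assms])
next
  fix r F assume *: "F \<in> splines E \<alpha>"
  have "l {x, y} dvd fun_scale r F x - fun_scale r F y" if "{x, y} \<in> E" for x y
    using * that unfolding fun_scale_def right_diff_distrib[symmetric]
    by (intro dvd_mult) (auto simp: splines_iff_dvd[OF assms])
  then show "fun_scale r F \<in> splines E \<alpha>"
    by (auto simp: splines_iff_dvd[OF assms])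
qed

text \<open>Since the graph is simple, a trail is determined by its nonempty list of vertices.\<close>

definition trail_edges :: "'v list \<Rightarrow> 'v set list" where
  "trail_edges p = map (\<lambda>(x, y). {x, y}) (zip p (tl p))"

definition is_trail :: "'v set set \<Rightarrow> 'v list \<Rightarrow> bool" where
  "is_trail E p \<longleftrightarrow> p \<noteq> [] \<and> set (trail_edges p) \<subseteq> E \<and> distinct (trail_edges p)"

definition zero_trails :: "'v set set \<Rightarrow> (nat \<Rightarrow> 'v) \<Rightarrow> nat \<Rightarrow> 'v list set" where
  "zero_trails E v i = {p. is_trail E p \<and> hd p = v i \<and> (\<exists>j\<in>{1..<i}. last p = v j)}"

definition trail_gcd :: "('v set \<Rightarrow> 'a::ring_gcd) \<Rightarrow> 'v list \<Rightarrow> 'a" where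
  "trail_gcd l p = Gcd\<^sub>f\<^sub>i\<^sub>n (l ` set (trail_edges p))"

text \<open>
  If \<open>v i\<close> has no zero trail, which happens when it is the first vertex of its connected component,
  the lcm is over the empty set and equals 1.
\<close>

definition lcm_zero_trails ::
    "'v set set \<Rightarrow> ('v set \<Rightarrow> 'a::ring_gcd) \<Rightarrow> (nat \<Rightarrow> 'v) \<Rightarrow> nat \<Rightarrow> 'a" where
  "lcm_zero_trails E l v i =
     (if i = 1 then 1 else Lcm\<^sub>f\<^sub>i\<^sub>n (trail_gcd l ` zero_trails E v i))"

text \<open>\<open>Lcm\<^sub>f\<^sub>i\<^sub>n\<close> is 0 on infinite sets; the next lemma shows that this does not occur.\<close>

lemma finite_zero_trails:
  fixes E :: "'v::finite set set"
  shows "finite (zero_trails E v i)"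
proof (rule finite_subset)
  show "zero_trails E v i \<subseteq> {p. set p \<subseteq> UNIV \<and> length p \<le> Suc (card (UNIV :: 'v set set))}"
  proof
    fix p assume "p \<in> zero_trails E v i"
    then have d: "distinct (trail_edges p)"
      by (simp add: zero_trails_def is_trail_def)
    have "length p - 1 = length (trail_edges p)"
      by (simp add: trail_edges_def)
    also have "\<dots> = card (set (trail_edges p))"
      using distinct_card[OF d] by simp
    also have "\<dots> \<le> card (UNIV :: 'v set set)"
      by (intro card_mono) auto
    finally show "p \<in> {p. set p \<subseteq> UNIV \<and> length p \<le> Suc (card (UNIV :: 'v set set))}"
      by simp
  qed
  show "finite {p :: 'v list. set p \<subseteq> UNIV \<and> length p \<le> Suc (card (UNIV :: 'v set set))}"
    by (rule finite_lists_length_le) simp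
qed

definition spline_Q ::
    "'v set set \<Rightarrow> ('v set \<Rightarrow> 'a::{idom, ring_gcd}) \<Rightarrow> (nat \<Rightarrow> 'v) \<Rightarrow> nat \<Rightarrow> 'a" where
  "spline_Q E l v n = (\<Prod>i=1..n. lcm_zero_trails E l v i)"

text \<open>
  Matrix indices start at 0, so column \<open>k\<close> belongs to the spline \<open>F (k + 1)\<close>; the rows run through
  the vertices in the order \<open>v n, \<dots>, v 1\<close>.
\<close>

definition spline_det ::
    "(nat \<Rightarrow> 'v) \<Rightarrow> nat \<Rightarrow> (nat \<Rightarrow> 'v \<Rightarrow> 'a::comm_ring_1) \<Rightarrow> 'a" where
  "spline_det v n F = det (mat n n (\<lambda>(i, k). F (k + 1) (v (n - i))))"

end

theory Submission
  imports Defs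
begin

text \<open>
  Modulo units a GCD domain is a distributive lattice in which multiplication distributes over gcd
  and lcm. Hence \<open>Q\<close> is the lcm of the products \<open>(p\<^sub>1) \<cdots> (p\<^sub>n)\<close> over all choices of zero trails
  \<open>p\<^sub>i\<close> of \<open>v i\<close>. Subtracting from the row of \<open>v i\<close> the row of the end of \<open>p\<^sub>i\<close> makes it divisible by
  \<open>(p\<^sub>i)\<close>, so \<open>Q\<close> divides the determinant of any \<open>n\<close> splines.

  Conversely, every set \<open>C\<close> of vertices carries the spline that is the lcm of the labels of the edges
  leaving \<open>C\<close> on \<open>C\<close> and 0 elsewhere. If \<open>C\<close> ranges over the sets containing \<open>v i\<close> but no earlier
  vertex, the gcd of these values divides the lcm over the zero trails of \<open>v i\<close> (a bottleneck duality
  valid in every distributive lattice), and one such spline for each \<open>i\<close> gives a triangular matrix.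
  So every common divisor of all determinants of \<open>n\<close> splines divides \<open>Q\<close>. The determinant of a basis
  is such a common divisor; that a determinant associated to \<open>Q\<close> comes from a basis is Cramer's rule.
\<close>

section \<open>Divisibility laws for gcds, lcms and determinants\<close>

lemma dvd_mult_Gcd_fin:
  fixes c d :: "'a::{idom, ring_gcd}"
  assumes "finite X" "\<And>x. x \<in> X \<Longrightarrow> d dvd c * x"
  shows "d dvd c * Gcd\<^sub>f\<^sub>i\<^sub>n X"
  using assms
proof (induction X)
  case (insert x X)
  then have "d dvd gcd (c * x) (c * Gcd\<^sub>f\<^sub>i\<^sub>n X)"
    by (intro gcd_greatest) auto
  then show ?case
    by (simp add: gcd_mult_left)
qed simp

lemma mult_Lcm_fin_dvd:
  fixes c d :: "'a::{idom, ring_gcd}"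
  assumes "finite X" "X \<noteq> {}" "\<And>x. x \<in> X \<Longrightarrow> c * x dvd d"
  shows "c * Lcm\<^sub>f\<^sub>i\<^sub>n X dvd d"
  using assms
proof (induction X rule: finite_ne_induct)
  case (insert x X)
  then have "lcm (c * x) (c * Lcm\<^sub>f\<^sub>i\<^sub>n X) dvd d"
    by (intro lcm_least) auto
  then show ?case
    by (simp add: lcm_mult_left)
next
  case (singleton x)
  have "c * normalize x dvd c * x"
    by (intro mult_dvd_mono) auto
  with singleton show ?case
    by (auto intro: dvd_trans)
qed

text \<open>Expanding the product turns it into a gcd over all choice functions \<open>x\<close>.
  The free factor \<open>c\<close> collects the elements already chosen in the induction.\<close>

lemma dvd_mult_prod_Gcd_fin:
  fixes c d :: "'a::{idom, ring_gcd}"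
  assumes "finite I" "\<And>i. i \<in> I \<Longrightarrow> finite (X i)"
    and "\<And>x. (\<And>i. i \<in> I \<Longrightarrow> x i \<in> X i) \<Longrightarrow> d dvd c * (\<Prod>i\<in>I. x i)"
  shows "d dvd c * (\<Prod>i\<in>I. Gcd\<^sub>f\<^sub>i\<^sub>n (X i))"
  using assms
proof (induction I arbitrary: c)
  case (insert i I)
  let ?P = "\<Prod>i\<in>I. Gcd\<^sub>f\<^sub>i\<^sub>n (X i)"
  have "d dvd c * ?P * a" if a: "a \<in> X i" for a
  proof -
    have "d dvd c * a * ?P"
    proof (rule insert.IH)
      fix x assume x: "\<And>i. i \<in> I \<Longrightarrow> x i \<in> X i"
      have "d dvd c * (\<Prod>j\<in>insert i I. (x(i := a)) j)"
        by (rule insert.prems(2)) (use x a in auto)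
      also have "(\<Prod>j\<in>insert i I. (x(i := a)) j) = a * (\<Prod>j\<in>I. x j)"
        using insert.hyps by (auto intro!: prod.cong)
      finally show "d dvd c * a * (\<Prod>j\<in>I. x j)"
        by (simp add: mult.assoc)
    qed (use insert.prems in auto)
    then show ?thesis
      by (simp add: mult_ac)
  qed
  then have "d dvd c * ?P * Gcd\<^sub>f\<^sub>i\<^sub>n (X i)"
    using insert.prems by (intro dvd_mult_Gcd_fin) auto
  then show ?case
    using insert.hyps by (simp add: mult_ac)
qed simp

text \<open>Dual expansion into an lcm. Nonemptiness matters: an empty \<open>X i\<close> has lcm 1
  but admits no choice, whereas an empty gcd is 0, which everything divides.\<close>

lemma mult_prod_Lcm_fin_dvd:
  fixes c d :: "'a::{idom, ring_gcd}"
  assumes "finite I" "\<And>i. i \<in> I \<Longrightarrow> finite (X i)" "\<And>i. i \<in> I \<Longrightarrow> X i \<noteq> {}"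
    and "\<And>x. (\<And>i. i \<in> I \<Longrightarrow> x i \<in> X i) \<Longrightarrow> c * (\<Prod>i\<in>I. x i) dvd d"
  shows "c * (\<Prod>i\<in>I. Lcm\<^sub>f\<^sub>i\<^sub>n (X i)) dvd d"
  using assms
proof (induction I arbitrary: c)
  case (insert i I)
  let ?P = "\<Prod>i\<in>I. Lcm\<^sub>f\<^sub>i\<^sub>n (X i)"
  have "c * ?P * a dvd d" if a: "a \<in> X i" for a
  proof -
    have "c * a * ?P dvd d"
    proof (rule insert.IH)
      fix x assume x: "\<And>i. i \<in> I \<Longrightarrow> x i \<in> X i"
      have "c * (\<Prod>j\<in>insert i I. (x(i := a)) j) dvd d"
        by (rule insert.prems(3)) (use x a in auto)
      also have "(\<Prod>j\<in>insert i I. (x(i := a)) j) = a * (\<Prod>j\<in>I. x j)"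
        using insert.hyps by (auto intro!: prod.cong)
      finally show "c * a * (\<Prod>j\<in>I. x j) dvd d"
        by (simp add: mult.assoc)
    qed (use insert.prems in auto)
    then show ?thesis
      by (simp add: mult_ac)
  qed
  then have "c * ?P * Lcm\<^sub>f\<^sub>i\<^sub>n (X i) dvd d"
    using insert.prems by (intro mult_Lcm_fin_dvd) auto
  then show ?case
    using insert.hyps by (simp add: mult_ac)
qed simp

text \<open>The classical identity is available only up to a unit, because normalization need not be
  multiplicative.\<close>

lemma normalize_lcm_mult_gcd:
  fixes a b :: "'a::ring_gcd"
  shows "normalize (lcm a b * gcd a b) = normalize (a * b)"
  by (simp add: lcm_gcd dvd_mult2)

text \<open>Multiplying by \<open>gcd b (gcd x y)\<close> turns the lcms into products, over which
  gcd distributes; the factor is then cancelled. If it is 0, so is the lcm.\<close>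

lemma dvd_lcm_gcd:
  fixes b m x y :: "'a::{idom, ring_gcd}"
  assumes "m dvd lcm b x" "m dvd lcm b y"
  shows "m dvd lcm b (gcd x y)"
proof (cases "gcd b (gcd x y) = 0")
  case False
  have *: "m * gcd b (gcd x y) dvd b * z" if "m dvd lcm b z" "gcd x y dvd z" for z
  proof -
    have "m * gcd b (gcd x y) dvd lcm b z * gcd b z"
      using that by (intro mult_dvd_mono gcd_mono) auto
    also have "lcm b z * gcd b z dvd b * z"
      by (simp add: associated_iff_dvd[THEN iffD1, OF normalize_lcm_mult_gcd])
    finally show ?thesis .
  qed
  have "m * gcd b (gcd x y) dvd gcd (b * x) (b * y)"
    using assms by (intro gcd_greatest *) auto
  then have "m * gcd b (gcd x y) dvd b * gcd x y"
    by (simp add: gcd_mult_left)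
  also have "\<dots> dvd lcm b (gcd x y) * gcd b (gcd x y)"
    by (simp add: associated_iff_dvd[THEN iffD1, OF normalize_lcm_mult_gcd])
  finally have "m * gcd b (gcd x y) dvd lcm b (gcd x y) * gcd b (gcd x y)" .
  then show ?thesis
    by (rule dvd_times_right_cancel_iff[OF False, THEN iffD1])
qed auto

lemma dvd_lcm_Gcd_fin:
  fixes b m :: "'a::{idom, ring_gcd}"
  assumes "finite X" "\<And>x. x \<in> X \<Longrightarrow> m dvd lcm b x"
  shows "m dvd lcm b (Gcd\<^sub>f\<^sub>i\<^sub>n X)"
  using assms by (induction X) (auto intro: dvd_lcm_gcd)

text \<open>
  This is the distributive law for a join of meets: the joins over transversals \<open>S\<close> of the
  family \<open>P\<close> are the terms of the expanded form.
\<close>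

lemma dvd_Lcm_fin_Gcd_fin:
  fixes a m :: "'a::{idom, ring_gcd}"
  assumes "finite P" "\<And>p. p \<in> P \<Longrightarrow> finite p"
    and "\<And>S. finite S \<Longrightarrow> S \<subseteq> \<Union>P \<Longrightarrow> (\<And>p. p \<in> P \<Longrightarrow> S \<inter> p \<noteq> {}) \<Longrightarrow>
           m dvd lcm a (Lcm\<^sub>f\<^sub>i\<^sub>n (l ` S))"
  shows "m dvd lcm a (Lcm\<^sub>f\<^sub>i\<^sub>n ((\<lambda>p. Gcd\<^sub>f\<^sub>i\<^sub>n (l ` p)) ` P))"
  using assms
proof (induction P arbitrary: a)
  case empty
  from empty.prems(2)[of "{}"] show ?case by simp
next
  case (insert p P)
  let ?L = "Lcm\<^sub>f\<^sub>i\<^sub>n ((\<lambda>p. Gcd\<^sub>f\<^sub>i\<^sub>n (l ` p)) ` P)"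
  \<comment> \<open>Distributivity reduces the gcd over \<open>p\<close> to single edges
    \<open>e\<close>. The label of \<open>e\<close> moves into \<open>a\<close>, and inserting
    \<open>e\<close> turns a transversal of \<open>P\<close> into one of
    \<open>insert p P\<close>.\<close>
  have "m dvd lcm (lcm a ?L) (l e)" if e: "e \<in> p" for e
  proof -
    have "m dvd lcm (lcm a (l e)) ?L"
    proof (rule insert.IH)
      fix S assume S: "finite S" "S \<subseteq> \<Union>P" "\<And>p. p \<in> P \<Longrightarrow> S \<inter> p \<noteq> {}"
      have "m dvd lcm a (Lcm\<^sub>f\<^sub>i\<^sub>n (l ` insert e S))"
        by (rule insert.prems(2)) (use S e in auto)
      then show "m dvd lcm (lcm a (l e)) (Lcm\<^sub>f\<^sub>i\<^sub>n (l ` S))"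
        by (simp add: lcm.assoc)
    qed (use insert.prems in auto)
    then show ?thesis
      by (simp add: lcm.assoc lcm.commute lcm.left_commute)
  qed
  then have "m dvd lcm (lcm a ?L) (Gcd\<^sub>f\<^sub>i\<^sub>n (l ` p))"
    using insert.prems by (intro dvd_lcm_Gcd_fin) auto
  then show ?case
    by (simp add: lcm.assoc lcm.commute lcm.left_commute)
qed

text \<open>Each Leibniz term takes exactly one entry from every row.\<close>

lemma prod_dvd_det:
  fixes A :: "'a::comm_ring_1 mat"
  assumes A: "A \<in> carrier_mat n n"
    and dvd: "\<And>i j. i < n \<Longrightarrow> j < n \<Longrightarrow> d i dvd A $$ (i, j)"
  shows "(\<Prod>i<n. d i) dvd det A"
  unfolding det_def'[OF A]
proof (intro dvd_sum dvd_mult)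
  fix p assume "p \<in> {p. p permutes {0..<n}}"
  then have "i < n \<Longrightarrow> p i < n" for i
    using permutes_in_image[of p "{0..<n}" i] by auto
  then show "(\<Prod>i<n. d i) dvd (\<Prod>i = 0..<n. A $$ (i, p i))"
    unfolding atLeast0LessThan by (intro prod_dvd_prod dvd) auto
qed

section \<open>Trails and the differences of spline values along them\<close>

lemma trail_edges_Nil [simp]: "trail_edges [] = []"
  by (simp add: trail_edges_def)

lemma trail_edges_Cons:
  "trail_edges (x # p) = (if p = [] then [] else {x, hd p} # trail_edges p)"
  by (cases p) (auto simp: trail_edges_def)

lemma trail_edges_append: "set (trail_edges q) \<subseteq> set (trail_edges (p @ q))"
  by (induction p) (auto simp: trail_edges_Cons)

lemma distinct_trail_edges_append:
  "distinct (trail_edges (p @ q)) \<Longrightarrow> distinct (trail_edges q)"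
  by (induction p) (auto simp: trail_edges_Cons split: if_splits)

lemma trail_edges_subset: "e \<in> set (trail_edges p) \<Longrightarrow> e \<subseteq> set p"
  by (induction p) (auto simp: trail_edges_Cons split: if_splits)

text \<open>If \<open>x\<close> already lies on the trail from \<open>z\<close>, its suffix from
  \<open>x\<close> serves; otherwise the new edge is fresh because it contains
  \<open>x\<close>.\<close>

lemma is_trail_if_reachable:
  assumes "(x, y) \<in> {(x, y). {x, y} \<in> E}\<^sup>*"
  shows "\<exists>p. is_trail E p \<and> hd p = x \<and> last p = y"
  using assms
proof (induction rule: converse_rtrancl_induct)
  case base
  show ?case
    by (rule exI[of _ "[y]"]) (simp add: is_trail_def trail_edges_def)
next
  case (step x z)
  then obtain p where p: "is_trail E p" "hd p = z" "last p = y" by blast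
  show ?case
  proof (cases "x \<in> set p")
    case True
    then obtain us ws where eq: "p = us @ x # ws" by (meson split_list)
    with p have "is_trail E (x # ws)"
      using trail_edges_append[of "x # ws" us] distinct_trail_edges_append[of us "x # ws"]
      by (auto simp: is_trail_def)
    with p eq show ?thesis
      by (intro exI[of _ "x # ws"]) auto
  next
    case False
    then have "{x, z} \<notin> set (trail_edges p)"
      using trail_edges_subset by fastforce
    with p step show ?thesis
      by (intro exI[of _ "x # p"]) (auto simp: is_trail_def trail_edges_Cons)
  qed
qed

text \<open>The difference between the ends telescopes over the edges.\<close>

lemma dvd_diff_along_trail:
  fixes F :: "'v \<Rightarrow> 'a::comm_ring_1"
  assumes "p \<noteq> []" "\<And>x y. {x, y} \<in> set (trail_edges p) \<Longrightarrow> d dvd F x - F y"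
  shows "d dvd F (hd p) - F (last p)"
  using assms
proof (induction p)
  case (Cons x p)
  show ?case
  proof (cases "p = []")
    case False
    with Cons have "d dvd (F x - F (hd p)) + (F (hd p) - F (last p))"
      by (intro dvd_add) (auto simp: trail_edges_Cons)
    with False show ?thesis by simp
  qed simp
qed simp

lemma trail_gcd_dvd_diff:
  fixes l :: "'v::finite set \<Rightarrow> 'a::{idom, ring_gcd}"
  assumes "edge_labeling E \<alpha> l" "F \<in> splines E \<alpha>" "is_trail E p"
  shows "trail_gcd l p dvd F (hd p) - F (last p)"
proof (rule dvd_diff_along_trail)
  fix x y assume xy: "{x, y} \<in> set (trail_edges p)"
  then have "trail_gcd l p dvd l {x, y}"
    unfolding trail_gcd_def by (intro Gcd_fin_dvd) auto
  also have "l {x, y} dvd F x - F y"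
    using assms xy by (auto simp: splines_iff_dvd is_trail_def)
  finally show "trail_gcd l p dvd F x - F y" .
qed (use assms in \<open>simp add: is_trail_def\<close>)

section \<open>Cuts, their splines, and duality with zero trails\<close>

definition cut_edges :: "'v set set \<Rightarrow> 'v set \<Rightarrow> 'v set set" where
  "cut_edges E C = {e \<in> E. \<exists>x\<in>C. \<exists>y. y \<notin> C \<and> e = {x, y}}"

text \<open>The least multiple, for divisibility, of the indicator of \<open>C\<close> that is a
  spline. An empty boundary gives the indicator itself, the empty lcm being 1.\<close>

definition cut_spline :: "'v set set \<Rightarrow> ('v set \<Rightarrow> 'a::ring_gcd) \<Rightarrow> 'v set \<Rightarrow> 'v \<Rightarrow> 'a" where
  "cut_spline E l C x = (if x \<in> C then Lcm\<^sub>f\<^sub>i\<^sub>n (l ` cut_edges E C) else 0)"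

lemma cut_spline_in_splines:
  fixes l :: "'v::finite set \<Rightarrow> 'a::{idom, ring_gcd}"
  assumes "edge_labeling E \<alpha> l"
  shows "cut_spline E l C \<in> splines E \<alpha>"
proof -
  have *: "l {x, y} dvd Lcm\<^sub>f\<^sub>i\<^sub>n (l ` cut_edges E C)" if "{x, y} \<in> E" "x \<in> C" "y \<notin> C" for x y
    using that by (intro dvd_Lcm_fin imageI) (auto simp: cut_edges_def)
  have "l {x, y} dvd cut_spline E l C x - cut_spline E l C y" if "{x, y} \<in> E" for x y
    using that *[of x y] *[of y x] by (simp add: cut_spline_def insert_commute)
  then show ?thesis
    by (simp add: splines_iff_dvd[OF assms])
qed

text \<open>Avoiding every earlier vertex serves twice: such cuts block all zero trails of
  \<open>v i\<close>, and their splines form a triangular matrix.\<close>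

definition separators :: "(nat \<Rightarrow> 'v) \<Rightarrow> nat \<Rightarrow> 'v set set" where
  "separators v i = {C. v i \<in> C \<and> (\<forall>j\<in>{1..<i}. v j \<notin> C)}"

text \<open>
  A set of edges meeting all zero trails of \<open>v i\<close> contains the cut around
  the component of \<open>v i\<close> that remains after its removal.
\<close>

lemma Gcd_fin_cuts_dvd_lcm_zero_trails:
  fixes l :: "'v::finite set \<Rightarrow> 'a::{idom, ring_gcd}"
  assumes "i \<ge> 1"
  shows "Gcd\<^sub>f\<^sub>i\<^sub>n ((\<lambda>C. Lcm\<^sub>f\<^sub>i\<^sub>n (l ` cut_edges E C)) ` separators v i) dvd lcm_zero_trails E l v i"
    (is "?m dvd _")
proof -
  let ?P = "(\<lambda>p. set (trail_edges p)) ` zero_trails E v i"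
  have "?m dvd lcm 1 (Lcm\<^sub>f\<^sub>i\<^sub>n ((\<lambda>p. Gcd\<^sub>f\<^sub>i\<^sub>n (l ` p)) ` ?P))"
  proof (rule dvd_Lcm_fin_Gcd_fin)
    fix S assume S: "S \<subseteq> \<Union>?P" "\<And>p. p \<in> ?P \<Longrightarrow> S \<inter> p \<noteq> {}"
    define C where "C = {w. (v i, w) \<in> {(x, y). {x, y} \<in> E - S}\<^sup>*}"
    \<comment> \<open>An earlier vertex in \<open>C\<close> would be the end of a zero trail
      avoiding \<open>S\<close>.\<close>
    have "v j \<notin> C" if j: "j \<in> {1..<i}" for j
    proof
      assume "v j \<in> C"
      then have "(v i, v j) \<in> {(x, y). {x, y} \<in> E - S}\<^sup>*"
        by (simp only: C_def mem_Collect_eq)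
      from is_trail_if_reachable[OF this]
      obtain p where p: "is_trail (E - S) p" "hd p = v i" "last p = v j"
        by (elim exE conjE)
      then have "p \<in> zero_trails E v i"
        using j by (auto simp: zero_trails_def is_trail_def)
      then have "S \<inter> set (trail_edges p) \<noteq> {}"
        using S by blast
      with p show False
        by (auto simp: is_trail_def)
    qed
    then have "C \<in> separators v i"
      by (auto simp: separators_def C_def)
    then have "?m dvd Lcm\<^sub>f\<^sub>i\<^sub>n (l ` cut_edges E C)"
      by (intro Gcd_fin_dvd) auto
    also have "cut_edges E C \<subseteq> S"
    proof
      fix e assume "e \<in> cut_edges E C"
      then obtain x y where e: "e \<in> E" "x \<in> C" "y \<notin> C" "e = {x, y}"
        by (auto simp: cut_edges_def)
      show "e \<in> S"
      proof (rule ccontr)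
        assume "e \<notin> S"
        with e have "y \<in> C"
          unfolding C_def by (auto intro: rtrancl_into_rtrancl)
        with e show False by simp
      qed
    qed
    then have "Lcm\<^sub>f\<^sub>i\<^sub>n (l ` cut_edges E C) dvd Lcm\<^sub>f\<^sub>i\<^sub>n (l ` S)"
      by (intro Lcm_fin_least dvd_Lcm_fin) auto
    finally show "?m dvd lcm 1 (Lcm\<^sub>f\<^sub>i\<^sub>n (l ` S))"
      by simp
  qed (auto simp: finite_zero_trails)
  also have "lcm 1 (Lcm\<^sub>f\<^sub>i\<^sub>n ((\<lambda>p. Gcd\<^sub>f\<^sub>i\<^sub>n (l ` p)) ` ?P)) =
      Lcm\<^sub>f\<^sub>i\<^sub>n (trail_gcd l ` zero_trails E v i)"
    by (simp add: image_image trail_gcd_def)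
  \<comment> \<open>For \<open>i = 1\<close> no zero trail exists, and the empty lcm is the
    prescribed 1.\<close>
  also have "\<dots> = lcm_zero_trails E l v i"
    by (simp add: lcm_zero_trails_def zero_trails_def)
  finally show ?thesis .
qed

text \<open>By injectivity of \<open>v\<close> a zero trail has distinct ends, hence an edge, and
  its gcd divides a nonzero label.\<close>

lemma lcm_zero_trails_nonzero:
  fixes l :: "'v::finite set \<Rightarrow> 'a::{idom, ring_gcd}"
  assumes "edge_labeling E \<alpha> l" "inj_on v {1..n}" "i \<in> {1..n}"
  shows "lcm_zero_trails E l v i \<noteq> 0"
proof -
  have "trail_gcd l p \<noteq> 0" if "p \<in> zero_trails E v i" for p
  proof -
    from that obtain j where j: "j \<in> {1..<i}" "last p = v j" "hd p = v i" and t: "is_trail E p"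
      by (auto simp: zero_trails_def)
    have "v i \<noteq> v j"
      using inj_onD[OF assms(2), of i j] j assms(3) by auto
    with j t obtain x y q where p: "p = x # y # q"
      by (cases p rule: remdups_adj.cases) (auto simp: is_trail_def)
    with t have "{x, y} \<in> E" "{x, y} \<in> set (trail_edges p)"
      by (auto simp: is_trail_def trail_edges_def)
    then have "trail_gcd l p dvd l {x, y}" "l {x, y} \<noteq> 0"
      using assms(1) by (auto simp: trail_gcd_def edge_labeling_def intro!: Gcd_fin_dvd)
    then show ?thesis by auto
  qed
  then show ?thesis
    using finite_zero_trails[of E v i] by (auto simp: lcm_zero_trails_def Lcm_fin_0_iff)
qed


section \<open>Determinants of splines compared with \<open>spline_Q\<close>\<close>

definition spline_mat :: "(nat \<Rightarrow> 'v) \<Rightarrow> nat \<Rightarrow> (nat \<Rightarrow> 'v \<Rightarrow> 'a) \<Rightarrow> 'a mat" where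
  "spline_mat v n F = mat n n (\<lambda>(i, k). F (k + 1) (v (n - i)))"

lemma spline_mat_carrier [simp]: "spline_mat v n F \<in> carrier_mat n n"
  by (simp add: spline_mat_def)

lemma spline_det_eq: "spline_det v n F = det (spline_mat v n F)"
  by (simp add: spline_det_def spline_mat_def)

lemma prod_diff_index: "(\<Prod>i<n. f (n - i)) = (\<Prod>i = 1..n. f i)" for n :: nat
  by (rule prod.reindex_bij_witness[of _ "\<lambda>i. n - i" "\<lambda>i. n - i"]) auto

text \<open>
  Subtracting the row of \<open>v (j i)\<close> from the row of \<open>v i\<close> for all \<open>i\<close> at once is multiplication
  by a unipotent matrix, because \<open>j i < i\<close>; \<open>j i = 0\<close> stands for no subtraction.
\<close>

lemma prod_dvd_spline_det:
  fixes F :: "nat \<Rightarrow> 'v \<Rightarrow> 'a::comm_ring_1"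
  assumes j: "\<And>i. i \<in> {1..n} \<Longrightarrow> j i < i"
    and d: "\<And>i k. i \<in> {1..n} \<Longrightarrow> k \<in> {1..n} \<Longrightarrow>
      d i dvd F k (v i) - (if j i = 0 then 0 else F k (v (j i)))"
  shows "(\<Prod>i = 1..n. d i) dvd spline_det v n F"
proof -
  \<comment> \<open>Row \<open>r\<close> belongs to \<open>v (n - r)\<close>. Since
    \<open>j (n - r) < n - r\<close>, each -1 lies right of the diagonal; if
    \<open>j (n - r) = 0\<close> there is none, as \<open>n - s > 0\<close> for all columns
    \<open>s\<close>.\<close>
  define U :: "'a mat" where
    "U = mat n n (\<lambda>(r, s). if s = r then 1 else if n - s = j (n - r) then - 1 else 0)"
  have U: "U \<in> carrier_mat n n"
    by (simp add: U_def)
  have "n - r \<in> {1..n}" if "r < n" for r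
    using that by auto
  note j' = j[OF this]
  have "upper_triangular U"
    using j' by (fastforce simp: U_def upper_triangular_def)
  then have "det U = 1"
    by (simp add: det_upper_triangular[OF _ U] prod_list_diag_prod) (simp add: U_def)
  moreover have "(\<Prod>r<n. d (n - r)) dvd det (U * spline_mat v n F)"
  proof (rule prod_dvd_det)
    fix r k assume r: "r < n" and k: "k < n"
    have "(U * spline_mat v n F) $$ (r, k) = (\<Sum>s<n. U $$ (r, s) * F (k + 1) (v (n - s)))"
      using r k U by (auto simp: scalar_prod_def spline_mat_def atLeast0LessThan intro!: sum.cong)
    also have "\<dots> = (\<Sum>s<n. (if s = r then F (k + 1) (v (n - r)) else 0) -
        (if s = n - j (n - r) then F (k + 1) (v (j (n - r))) else 0))"
      using r j'[OF r] by (intro sum.cong) (auto simp: U_def)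
    also have "\<dots> = F (k + 1) (v (n - r)) -
        (if j (n - r) = 0 then 0 else F (k + 1) (v (j (n - r))))"
      using r j'[OF r] by (auto simp: sum_subtractf)
    finally show "d (n - r) dvd (U * spline_mat v n F) $$ (r, k)"
      using r k d[of "n - r" "k + 1"] by simp
  qed (use U in auto)
  ultimately show ?thesis
    by (simp add: det_mult[OF U] spline_det_eq prod_diff_index)
qed

lemma spline_Q_dvd_spline_det:
  fixes l :: "'v::finite set \<Rightarrow> 'a::{idom, ring_gcd}"
  assumes lab: "edge_labeling E \<alpha> l" and F: "F ` {1..n} \<subseteq> splines E \<alpha>"
  shows "spline_Q E l v n dvd spline_det v n F"
proof -
  \<comment> \<open>The extra 1 leaves the lcm unchanged but makes \<open>X i\<close> nonempty;
    choosing it means that no row is subtracted (\<open>j = 0\<close>).\<close>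
  define X where "X i = insert 1 (trail_gcd l ` zero_trails E v i)" for i
  have "1 * (\<Prod>i = 1..n. Lcm\<^sub>f\<^sub>i\<^sub>n (X i)) dvd spline_det v n F"
  proof (rule mult_prod_Lcm_fin_dvd)
    fix x assume x: "\<And>i. i \<in> {1..n} \<Longrightarrow> x i \<in> X i"
    have "\<exists>j<i. \<forall>k\<in>{1..n}. x i dvd F k (v i) - (if j = 0 then 0 else F k (v j))"
      if i: "i \<in> {1..n}" for i
    proof (cases "x i = 1")
      case True
      with i show ?thesis by (auto intro!: exI[of _ 0])
    next
      case False
      with x[OF i] obtain p where p: "p \<in> zero_trails E v i" "x i = trail_gcd l p"
        by (auto simp: X_def)
      then obtain j where j: "j \<in> {1..<i}" "is_trail E p" "hd p = v i" "last p = v j"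
        by (auto simp: zero_trails_def)
      with p F have "\<forall>k\<in>{1..n}. x i dvd F k (v i) - F k (v j)"
        using trail_gcd_dvd_diff[OF lab, of _ p] by fastforce
      with j show ?thesis
        by (intro exI[of _ j]) auto
    qed
    then obtain j where "\<And>i. i \<in> {1..n} \<Longrightarrow> j i < i"
      "\<And>i k. i \<in> {1..n} \<Longrightarrow> k \<in> {1..n} \<Longrightarrow>
        x i dvd F k (v i) - (if j i = 0 then 0 else F k (v (j i)))"
      by metis
    then show "1 * (\<Prod>i = 1..n. x i) dvd spline_det v n F"
      using prod_dvd_spline_det[of n j x F v] by simp
  qed (auto simp: X_def finite_zero_trails)
  moreover have "Lcm\<^sub>f\<^sub>i\<^sub>n (X i) = lcm_zero_trails E l v i" for i
    by (simp add: X_def lcm_zero_trails_def zero_trails_def)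
  ultimately show ?thesis
    by (simp add: spline_Q_def)
qed

text \<open>It is enough to test \<open>d\<close> on cut splines: their determinants are products of
  boundary lcms, and the gcd over all choices of separators divides Q.\<close>

lemma dvd_spline_Q:
  fixes l :: "'v::finite set \<Rightarrow> 'a::{idom, ring_gcd}"
  assumes lab: "edge_labeling E \<alpha> l"
    and d: "\<And>G. G ` {1..n} \<subseteq> splines E \<alpha> \<Longrightarrow> d dvd spline_det v n G"
  shows "d dvd spline_Q E l v n"
proof -
  define X where "X i = (\<lambda>C. Lcm\<^sub>f\<^sub>i\<^sub>n (l ` cut_edges E C)) ` separators v i" for i
  have "d dvd 1 * (\<Prod>i = 1..n. Gcd\<^sub>f\<^sub>i\<^sub>n (X i))"
  proof (rule dvd_mult_prod_Gcd_fin)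
    fix x assume "\<And>i. i \<in> {1..n} \<Longrightarrow> x i \<in> X i"
    then have "\<exists>C. C \<in> separators v i \<and> x i = Lcm\<^sub>f\<^sub>i\<^sub>n (l ` cut_edges E C)" if "i \<in> {1..n}" for i
      using that by (fastforce simp: X_def)
    then obtain C where C: "\<And>i. i \<in> {1..n} \<Longrightarrow> C i \<in> separators v i"
      "\<And>i. i \<in> {1..n} \<Longrightarrow> x i = Lcm\<^sub>f\<^sub>i\<^sub>n (l ` cut_edges E (C i))"
      by metis
    \<comment> \<open>the reversed order of the columns makes the matrix upper triangular\<close>
    define G where "G k = cut_spline E l (C (n + 1 - k))" for k
    have "upper_triangular (spline_mat v n G)"
      unfolding upper_triangular_def
    proof (intro allI impI)
      fix r k assume r: "r < dim_row (spline_mat v n G)" and k: "k < r"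
      \<comment> \<open>Column \<open>k\<close> is the spline of \<open>C (n - k)\<close>; below the
        diagonal the vertex \<open>v (n - r)\<close> is earlier than \<open>v (n - k)\<close>, so
        this set avoids it.\<close>
      have "n - r \<in> {1..<n - k}"
        using r k by (auto simp: spline_mat_def)
      then have "v (n - r) \<notin> C (n - k)"
        using C(1)[of "n - k"] by (auto simp: separators_def)
      with r k show "spline_mat v n G $$ (r, k) = 0"
        by (simp add: spline_mat_def G_def cut_spline_def)
    qed
    then have "spline_det v n G = (\<Prod>r<n. spline_mat v n G $$ (r, r))"
      by (simp add: spline_det_eq det_upper_triangular[of _ n] prod_list_diag_prod atLeast0LessThan)
        (simp add: spline_mat_def)
    also have "\<dots> = (\<Prod>r<n. x (n - r))"
    proof (rule prod.cong)
      fix r assume "r \<in> {..<n}"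
      then show "spline_mat v n G $$ (r, r) = x (n - r)"
        using C[of "n - r"] by (auto simp: spline_mat_def G_def cut_spline_def separators_def)
    qed simp
    finally have "spline_det v n G = (\<Prod>i = 1..n. x i)"
      by (simp only: prod_diff_index)
    moreover have "d dvd spline_det v n G"
      by (rule d) (auto simp: G_def cut_spline_in_splines[OF lab])
    ultimately show "d dvd 1 * (\<Prod>i = 1..n. x i)"
      by simp
  qed (auto simp: X_def)
  also have "\<dots> dvd spline_Q E l v n"
    unfolding spline_Q_def mult_1 X_def
    by (intro prod_dvd_prod Gcd_fin_cuts_dvd_lcm_zero_trails) auto
  finally show ?thesis .
qed

section \<open>Spans, independence and Cramer's rule\<close>

text \<open>Spans refer to sets of functions, matrices to indices. As \<open>F\<close> may repeat,
  each step charges its coefficient to one index chosen for the function.\<close>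

lemma span_image_imp_sum:
  fixes F :: "'i \<Rightarrow> 'v \<Rightarrow> 'a::comm_ring_1"
  assumes "G \<in> fun_mod.span (F ` I)" "finite I"
  shows "\<exists>c. \<forall>x. G x = (\<Sum>k\<in>I. c k * F k x)"
  using assms(1)
proof (induction rule: fun_mod.span_induct_alt)
  case base
  show ?case by (rule exI[of _ "\<lambda>_. 0"]) simp
next
  case (step a f G)
  then obtain k c where k: "k \<in> I" "f = F k" and c: "\<And>x. G x = (\<Sum>k\<in>I. c k * F k x)"
    by blast
  have "(\<Sum>i\<in>I. (c i + (if i = k then a else 0)) * F i x) = a * F k x + G x" for x
    using k assms(2) by (simp add: c distrib_right sum.distrib if_distrib[of "\<lambda>z. z * _"] cong: if_cong)
  then show ?case
    using k by (intro exI[of _ "\<lambda>i. c i + (if i = k then a else 0)"]) (simp add: fun_scale_def)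
qed

text \<open>The matrix of \<open>G\<close> is that of \<open>F\<close> times the coefficient matrix,
  and determinants are multiplicative.\<close>

lemma spline_det_dvd_if_spanned:
  assumes G: "\<And>k. k \<in> {1..n} \<Longrightarrow> G k \<in> fun_mod.span (F ` {1..n})"
  shows "spline_det v n F dvd spline_det v n G"
proof -
  have "\<exists>c. \<forall>x. G k x = (\<Sum>i = 1..n. c i * F i x)" if "k \<in> {1..n}" for k
    by (rule span_image_imp_sum) (use G that in auto)
  then obtain c where c: "\<And>k x. k \<in> {1..n} \<Longrightarrow> G k x = (\<Sum>i = 1..n. c k i * F i x)"
    by metis
  define C where "C = mat n n (\<lambda>(i, k). c (k + 1) (i + 1))"
  have C: "C \<in> carrier_mat n n"
    by (simp add: C_def)
  have "spline_mat v n G = spline_mat v n F * C"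
  proof (rule eq_matI)
    fix r k assume "r < dim_row (spline_mat v n F * C)" "k < dim_col (spline_mat v n F * C)"
    then have r: "r < n" and k: "k < n"
      using C by (auto simp: spline_mat_def)
    have "(\<Sum>i = 1..n. c (k + 1) i * F i (v (n - r))) =
        (\<Sum>i<n. F (i + 1) (v (n - r)) * c (k + 1) (i + 1))"
      by (rule sum.reindex_bij_witness[of _ Suc "\<lambda>i. i - 1"]) auto
    with r k show "spline_mat v n G $$ (r, k) = (spline_mat v n F * C) $$ (r, k)"
      using c[of "k + 1"]
      by (simp add: spline_mat_def C_def scalar_prod_def atLeast0LessThan)
  qed (auto simp: spline_mat_def C_def)
  then show ?thesis
    using det_mult[OF spline_mat_carrier C, of v F] by (simp add: spline_det_eq)
qed

lemma inj_on_if_spline_det_nonzero: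
  assumes "spline_det v n F \<noteq> 0"
  shows "inj_on F {1..n}"
proof (rule inj_onI, rule ccontr)
  fix a b assume ab: "a \<in> {1..n}" "b \<in> {1..n}" "F a = F b" "a \<noteq> b"
  then have "col (spline_mat v n F) (a - 1) = col (spline_mat v n F) (b - 1)"
    by (intro eq_vecI) (auto simp: spline_mat_def)
  then have "det (spline_mat v n F) = 0"
    using ab by (intro det_identical_columns[of _ n "a - 1" "b - 1"]) auto
  with assms show False
    by (simp add: spline_det_eq)
qed

text \<open>The adjugate turns \<open>A w = 0\<close> into \<open>det A * w = 0\<close>, where the
  nonzero determinant cancels.\<close>

lemma coeffs_zero_if_spline_det_nonzero:
  fixes F :: "nat \<Rightarrow> 'v \<Rightarrow> 'a::idom"
  assumes det: "spline_det v n F \<noteq> 0"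
    and eq: "\<And>x. (\<Sum>k = 1..n. c k * F k x) = 0" and i: "i \<in> {1..n}"
  shows "c i = 0"
proof -
  let ?A = "spline_mat v n F"
  define w where "w = vec n (\<lambda>k. c (k + 1))"
  have w: "w \<in> carrier_vec n"
    by (simp add: w_def)
  have "?A *\<^sub>v w = 0\<^sub>v n"
  proof (rule eq_vecI)
    fix r assume r: "r < dim_vec (0\<^sub>v n :: 'a vec)"
    have "(\<Sum>k<n. F (k + 1) (v (n - r)) * c (k + 1)) = (\<Sum>k = 1..n. c k * F k (v (n - r)))"
      by (rule sum.reindex_bij_witness[of _ "\<lambda>k. k - 1" Suc]) auto
    with r eq show "(?A *\<^sub>v w) $ r = 0\<^sub>v n $ r"
      by (simp add: spline_mat_def w_def scalar_prod_def atLeast0LessThan)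
  qed (simp add: spline_mat_def)
  have "det ?A \<cdot>\<^sub>v w = (adj_mat ?A * ?A) *\<^sub>v w"
    using adj_mat(3)[OF spline_mat_carrier, of v n F] w by auto
  also have "\<dots> = adj_mat ?A *\<^sub>v (?A *\<^sub>v w)"
    using adj_mat(1)[OF spline_mat_carrier, of v n F] w by (intro assoc_mult_mat_vec[of _ n n _ n]) auto
  also have "\<dots> = 0\<^sub>v n"
    using \<open>?A *\<^sub>v w = 0\<^sub>v n\<close> adj_mat(1)[OF spline_mat_carrier, of v n F] by auto
  finally have "(det ?A \<cdot>\<^sub>v w) $ (i - 1) = 0\<^sub>v n $ (i - 1)"
    by simp
  moreover have "i - 1 < n"
    using i by auto
  ultimately show ?thesis
    using det i by (simp add: w_def spline_det_eq)
qed

lemma independent_if_spline_det_nonzero: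
  fixes F :: "nat \<Rightarrow> 'v \<Rightarrow> 'a::idom"
  assumes det: "spline_det v n F \<noteq> 0"
  shows "fun_mod.independent (F ` {1..n})"
  unfolding fun_mod.independent_explicit_module
proof (intro allI impI)
  fix t u f assume t: "t \<subseteq> F ` {1..n}" and sum: "(\<Sum>f\<in>t. fun_scale (u f) f) = 0" and f: "f \<in> t"
  \<comment> \<open>The coefficients \<open>u\<close> live on functions in \<open>t\<close>; they
    are extended by 0 to all indices, which injectivity of \<open>F\<close> permits.\<close>
  let ?c = "\<lambda>k. if F k \<in> t then u (F k) else 0"
  have "(\<Sum>k = 1..n. ?c k * F k x) = 0" for x
  proof -
    have "(\<Sum>k = 1..n. ?c k * F k x) = (\<Sum>f\<in>F ` {1..n}. (if f \<in> t then u f else 0) * f x)"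
      by (simp only: sum.reindex[OF inj_on_if_spline_det_nonzero[OF det]] o_def)
    also have "\<dots> = (\<Sum>f\<in>t. u f * f x)"
      using t by (intro sum.mono_neutral_cong_right) auto
    also have "\<dots> = (\<Sum>f\<in>t. fun_scale (u f) f) x"
      by (induction t rule: infinite_finite_induct) (auto simp: fun_scale_def)
    finally show ?thesis
      by (simp add: sum)
  qed
  then have "?c k = 0" if "k \<in> {1..n}" for k
    using coeffs_zero_if_spline_det_nonzero[OF det, of ?c k] that by blast
  with t f show "u f = 0"
    by fastforce
qed

text \<open>Cramer's rule without division: apply \<open>A * adj A = det A * 1\<close> to the column
  of \<open>G\<close>.\<close>

lemma spline_cramer:
  fixes F :: "nat \<Rightarrow> 'v \<Rightarrow> 'a::comm_ring_1"
  assumes "i \<in> {1..n}"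
  shows "spline_det v n F * G (v i) = (\<Sum>k = 1..n. spline_det v n (F(k := G)) * F k (v i))"
proof -
  let ?A = "spline_mat v n F"
  define b where "b = vec n (\<lambda>r. G (v (n - r)))"
  note adj = adj_mat[OF spline_mat_carrier, of v n F]
  have b: "b \<in> carrier_vec n"
    by (simp add: b_def)
  have coord: "(adj_mat ?A *\<^sub>v b) $ k = spline_det v n (F(k + 1 := G))" if k: "k < n" for k
  proof -
    let ?B = "spline_mat v n (F(k + 1 := G))"
    \<comment> \<open>The two matrices differ only in the deleted column, so their cofactors along
      it agree.\<close>
    have "mat_delete ?B r k = mat_delete ?A r k" for r
      by (rule eq_matI) (auto simp: mat_delete_def spline_mat_def)
    moreover have "spline_det v n (F(k + 1 := G)) = (\<Sum>r<n. ?B $$ (r, k) * cofactor ?B r k)"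
      unfolding spline_det_eq using k by (intro laplace_expansion_column) auto
    ultimately show ?thesis
      using k adj(1)
      by (auto simp: scalar_prod_def adj_mat_def b_def cofactor_def spline_mat_def
        atLeast0LessThan mult.commute intro!: sum.cong)
  qed
  have "det ?A \<cdot>\<^sub>v b = (?A * adj_mat ?A) *\<^sub>v b"
    using adj(2) b by auto
  also have "\<dots> = ?A *\<^sub>v (adj_mat ?A *\<^sub>v b)"
    using adj(1) b by (intro assoc_mult_mat_vec[of _ n n _ n]) auto
  finally have "(det ?A \<cdot>\<^sub>v b) $ (n - i) = (?A *\<^sub>v (adj_mat ?A *\<^sub>v b)) $ (n - i)"
    by simp
  also have "\<dots> = (\<Sum>k<n. F (k + 1) (v i) * spline_det v n (F(k + 1 := G)))"
    using assms coord adj(1) by (simp add: scalar_prod_def spline_mat_def atLeast0LessThan)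
  also have "\<dots> = (\<Sum>k = 1..n. spline_det v n (F(k := G)) * F k (v i))"
    by (rule sum.reindex_bij_witness[of _ "\<lambda>k. k - 1" Suc]) auto
  finally show ?thesis
    using assms by (simp add: b_def spline_det_eq)
qed

text \<open>The quotients in Cramer's rule are the coefficients; surjectivity of \<open>v\<close>
  carries the identity to all vertices.\<close>

lemma in_span_if_spline_det_dvd:
  fixes F :: "nat \<Rightarrow> 'v \<Rightarrow> 'a::idom"
  assumes v: "v ` {1..n} = UNIV" and det: "spline_det v n F \<noteq> 0"
    and dvd: "\<And>k. k \<in> {1..n} \<Longrightarrow> spline_det v n F dvd spline_det v n (F(k := G))"
  shows "G \<in> fun_mod.span (F ` {1..n})"
proof -
  obtain c where c: "\<And>k. k \<in> {1..n} \<Longrightarrow> spline_det v n (F(k := G)) = spline_det v n F * c k"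
    using dvd unfolding dvd_def by metis
  have "G x = (\<Sum>k = 1..n. fun_scale (c k) (F k)) x" for x
  proof -
    obtain i where i: "i \<in> {1..n}" "x = v i"
      using v by (metis UNIV_I imageE)
    have "spline_det v n F * G x = (\<Sum>k = 1..n. spline_det v n F * c k * F k x)"
      using spline_cramer[OF i(1), of v F G] i c by simp
    also have "\<dots> = spline_det v n F * (\<Sum>k = 1..n. c k * F k x)"
      by (simp add: sum_distrib_left mult.assoc)
    also have "(\<Sum>k = 1..n. c k * F k x) = (\<Sum>k = 1..n. fun_scale (c k) (F k)) x"
      by (induction n) (auto simp: fun_scale_def)
    finally show ?thesis
      using det by simp
  qed
  then have "G = (\<Sum>k = 1..n. fun_scale (c k) (F k))"
    by blast
  also have "\<dots> \<in> fun_mod.span (F ` {1..n})"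
    by (intro fun_mod.span_sum fun_mod.span_scale fun_mod.span_base imageI)
  finally show ?thesis .
qed

theorem theorem5p3:
  fixes E :: "'v::finite set set"
    and n :: nat
    and v :: "nat \<Rightarrow> 'v"
    and \<alpha> :: "'v set \<Rightarrow> 'a::{idom, ring_gcd} set"
    and l :: "'v set \<Rightarrow> 'a"
    and F :: "nat \<Rightarrow> 'v \<Rightarrow> 'a"
  assumes "simple_graph E"
    and "bij_betw v {1..n} UNIV"
    and "edge_labeling E \<alpha> l"
    and "F ` {1..n} \<subseteq> splines E \<alpha>"
  shows "module_basis (F ` {1..n}) (splines E \<alpha>) \<longleftrightarrow>
    (\<exists>r. is_unit r \<and> spline_det v n F = r * spline_Q E l v n)"
proof
  let ?D = "spline_det v n F" and ?Q = "spline_Q E l v n"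
  \<comment> \<open>Both directions rest on this: one cancels \<open>?Q\<close>, the other needs
    \<open>?D\<close> nonzero for independence and Cramer's rule.\<close>
  have Q_nonzero: "?Q \<noteq> 0"
    using lcm_zero_trails_nonzero[OF assms(3)] assms(2)
    by (auto simp: spline_Q_def bij_betw_def)
  {
    assume "module_basis (F ` {1..n}) (splines E \<alpha>)"
    then have "?D dvd ?Q"
      by (intro dvd_spline_Q[OF assms(3)] spline_det_dvd_if_spanned) (auto simp: module_basis_def)
    moreover have "?Q dvd ?D"
      by (rule spline_Q_dvd_spline_det[OF assms(3,4)])
    ultimately obtain r s where rs: "?D = ?Q * r" "?Q = ?D * s"
      by (elim dvdE)
    from rs(1)[symmetric] rs(2)[symmetric] have "?Q * (r * s) = ?Q * 1"
      by (simp only: mult.assoc[symmetric] mult_1_right)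
    then have "r * s = 1"
      by (rule mult_left_cancel[OF Q_nonzero, THEN iffD1])
    then have "is_unit r"
      by (metis dvd_triv_left)
    with rs(1) show "\<exists>r. is_unit r \<and> ?D = r * ?Q"
      by (auto simp: mult.commute)
  next
    assume "\<exists>r. is_unit r \<and> ?D = r * ?Q"
    then obtain r where r: "is_unit r" "?D = r * ?Q" by blast
    with Q_nonzero have D_nonzero: "?D \<noteq> 0" by auto
    have "G \<in> fun_mod.span (F ` {1..n})" if G: "G \<in> splines E \<alpha>" for G
    proof (rule in_span_if_spline_det_dvd[OF _ D_nonzero])
      fix k
      \<comment> \<open>Replacing a column by \<open>G\<close> leaves a family of splines;
        \<open>?D\<close> is associated to \<open>?Q\<close>, so it divides the new determinant
        too.\<close>
      have "?Q dvd spline_det v n (F(k := G))"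
        using assms(4) G by (intro spline_Q_dvd_spline_det[OF assms(3)]) auto
      with r show "?D dvd spline_det v n (F(k := G))"
        by (simp add: mult_unit_dvd_iff')
    qed (use assms(2) in \<open>simp add: bij_betw_def\<close>)
    moreover have "fun_mod.span (F ` {1..n}) \<subseteq> splines E \<alpha>"
      by (rule fun_mod.span_minimal[OF assms(4) subspace_splines[OF assms(3)]])
    ultimately show "module_basis (F ` {1..n}) (splines E \<alpha>)"
      using independent_if_spline_det_nonzero[OF D_nonzero] by (auto simp: module_basis_def)
  }
qed

end
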